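(* Let $\mathcal{A}$ be a commutative, associative, unital, finite-dimensional real algebra, let $p(x)\in\mathcal{A}[x]$ be a monic polynomial of degree $n\ge1$, and let $D=d/d\zeta$ denote the derivative operator on $\mathcal{A}$. Then the special functions $f_1,\dots,f_n:\mathcal{A}\to\mathcal{A}$ of the exponential on the characteristic extension algebra $\mathcal{A}'=\mathcal{A}[x]/\langle p(x)\rangle$ form a fundamental solution set of $p(D)[\eta]=0$ on $\mathcal{A}$.
   Context: For $U\subseteq\mathcal{A}$ open, $f:U\to\mathcal{A}$ is $\mathcal{A}$-differentiable at $q$ if there is a real-linear map $d_qf:\mathcal{A}\to\mathcal{A}$ with $d_qf(xy)=d_qf(x)y$ for all $x,y\in\mathcal{A}$ and $\lim_{h\to0}\frac{f(q+h)-f(q)-d_qf(h)}{\|h\|}=0$ (any norm on $\mathcal{A}$); then $Df(q)=f'(q)=d_qf(1)$, with $D^j$ the $j$-fold derivative. If $p(x)=x^n+a_{n-1}x^{n-1}+\cdots+a_0$ then $p(D)[\eta]=\eta^{(n)}+a_{n-1}\eta^{(n-1)}+\cdots+a_0\eta$. The characteristic extension algebra of $p(D)[\eta]=0$ is $\mathcal{A}'=\mathcal{A}[x]/\langle p(x)\rangle$; with $k=x+\langle p(x)\rangle$, it is a free $\mathcal{A}$-module with basis $1,k,\dots,k^{n-1}$. The special functions $f_1,\dots,f_n:\mathcal{A}\to\mathcal{A}$ of the exponential on $\mathcal{A}'$ are the unique functions with $$\exp(k\zeta)=f_1(\zeta)+f_2(\zeta)k+\cdots+f_n(\zeta)k^{n-1}\qquad(\zeta\in\mathcal{A}),$$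 where $\exp(u)=\sum_{m\ge0}u^m/m!$ in the finite-dimensional real algebra $\mathcal{A}'$. A fundamental solution set of $p(D)[\eta]=0$ on $\mathcal{A}$ is a set of $n$ functions $\mathcal{A}\to\mathcal{A}$, each ($n$-times $\mathcal{A}$-differentiable and) solving the equation on $\mathcal{A}$, that is linearly independent: $\sum_i c_if_i(\zeta)=0$ for all $\zeta\in\mathcal{A}$, with $c_i\in\mathcal{A}$, implies all $c_i=0$. *)

theory Defs
  imports "HOL-Algebra.Algebraic_Closure_Type" "HOL-Analysis.Analysis"
begin

text \<open>
  The algebra \<open>\<A>\<close> is a type of sort \<open>{euclidean_space, real_algebra_1, comm_ring_1}\<close>.  The class
  \<open>euclidean_space\<close> supplies finite dimension and a norm; it does not relate that norm to the
  multiplication.  (The class \<open>real_normed_algebra_1\<close> is avoided on purpose: together with a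
  Euclidean norm it would only admit very few algebras.)  In finite dimension the choice of norm
  affects neither limits nor derivatives.
\<close>

subsection \<open>Differentiation over the algebra\<close>

definition has_alg_differential ::
    "('a::{euclidean_space,real_algebra_1,comm_ring_1} \<Rightarrow> 'a) \<Rightarrow> ('a \<Rightarrow> 'a) \<Rightarrow> 'a \<Rightarrow> bool"
  where "has_alg_differential f d q \<longleftrightarrow>
    (f has_derivative d) (at q) \<and> (\<forall>x y. d (x * y) = d x * y)"

definition alg_differentiable ::
    "('a::{euclidean_space,real_algebra_1,comm_ring_1} \<Rightarrow> 'a) \<Rightarrow> 'a \<Rightarrow> bool"
  where "alg_differentiable f q \<longleftrightarrow> (\<exists>d. has_alg_differential f d q)"

definition alg_deriv ::
    "('a::{euclidean_space,real_algebra_1,comm_ring_1} \<Rightarrow> 'a) \<Rightarrow> 'a \<Rightarrow> 'a"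
  where "alg_deriv f q = (THE d. has_alg_differential f d q) 1"

definition times_alg_differentiable ::
    "nat \<Rightarrow> ('a::{euclidean_space,real_algebra_1,comm_ring_1} \<Rightarrow> 'a) \<Rightarrow> bool"
  where "times_alg_differentiable n f \<longleftrightarrow>
    (\<forall>j<n. \<forall>q. alg_differentiable ((alg_deriv ^^ j) f) q)"

definition poly_deriv_op ::
    "'a::{euclidean_space,real_algebra_1,comm_ring_1} poly \<Rightarrow> ('a \<Rightarrow> 'a) \<Rightarrow> 'a \<Rightarrow> 'a"
  where "poly_deriv_op p f \<zeta> =
    (\<Sum>i\<le>Polynomial.degree p. Polynomial.coeff p i * (alg_deriv ^^ i) f \<zeta>)"

definition fundamental_solution_set ::
    "'a::{euclidean_space,real_algebra_1,comm_ring_1} poly \<Rightarrow> ('a \<Rightarrow> 'a) set \<Rightarrow> bool"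
  where "fundamental_solution_set p S \<longleftrightarrow>
    finite S \<and> card S = Polynomial.degree p \<and>
    (\<forall>f\<in>S. times_alg_differentiable (Polynomial.degree p) f \<and> (\<forall>\<zeta>. poly_deriv_op p f \<zeta> = 0)) \<and>
    (\<forall>c :: ('a \<Rightarrow> 'a) \<Rightarrow> 'a. (\<forall>\<zeta>. (\<Sum>f\<in>S. c f * f \<zeta>) = 0) \<longrightarrow> (\<forall>f\<in>S. c f = 0))"

subsection \<open>The characteristic extension algebra\<close>

text \<open>
  The quotient \<open>\<A>[x]/\<langle>p\<rangle>\<close> depends on the term \<open>p\<close>, so it is a ring with an explicit carrier whose
  elements are cosets.
\<close>

definition char_ext :: "'a::comm_ring_1 poly \<Rightarrow> 'a poly set ring"
  where "char_ext p = ring_of_type_algebra Quot (PIdl\<^bsub>ring_of_type_algebra\<^esub> p)"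

definition ext_class :: "'a::comm_ring_1 poly \<Rightarrow> 'a poly \<Rightarrow> 'a poly set"
  where "ext_class p q = (PIdl\<^bsub>ring_of_type_algebra\<^esub> p) +>\<^bsub>ring_of_type_algebra\<^esub> q"

definition ext_emb :: "'a::comm_ring_1 poly \<Rightarrow> 'a \<Rightarrow> 'a poly set"
  where "ext_emb p a = ext_class p [:a:]"

definition ext_gen :: "'a::comm_ring_1 poly \<Rightarrow> 'a poly set"
  where "ext_gen p = ext_class p [:0, 1:]"

definition ext_scale :: "'a::{real_algebra_1,comm_ring_1} poly \<Rightarrow> real \<Rightarrow> 'a poly set \<Rightarrow> 'a poly set"
  where "ext_scale p r u = ext_emb p (of_real r) \<otimes>\<^bsub>char_ext p\<^esub> u"

definition ext_norm :: "'a::{real_algebra_1,comm_ring_1} poly \<Rightarrow> ('a poly set \<Rightarrow> real) \<Rightarrow> bool"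
  where "ext_norm p N \<longleftrightarrow>
    (\<forall>u\<in>carrier (char_ext p). 0 \<le> N u \<and> (N u = 0 \<longleftrightarrow> u = \<zero>\<^bsub>char_ext p\<^esub>)) \<and>
    (\<forall>u\<in>carrier (char_ext p). \<forall>v\<in>carrier (char_ext p). N (u \<oplus>\<^bsub>char_ext p\<^esub> v) \<le> N u + N v) \<and>
    (\<forall>r. \<forall>u\<in>carrier (char_ext p). N (ext_scale p r u) = \<bar>r\<bar> * N u)"

text \<open>
  Convergence in the finite-dimensional real vector space \<open>\<A>[x]/\<langle>p\<rangle>\<close>: since all norms on it are
  equivalent, requiring convergence for every norm is the same as requiring it for one.
\<close>

definition ext_tendsto ::
    "'a::{real_algebra_1,comm_ring_1} poly \<Rightarrow> (nat \<Rightarrow> 'a poly set) \<Rightarrow> 'a poly set \<Rightarrow> bool"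
  where "ext_tendsto p U l \<longleftrightarrow>
    (\<forall>N. ext_norm p N \<longrightarrow> (\<lambda>m. N (U m \<ominus>\<^bsub>char_ext p\<^esub> l)) \<longlonglongrightarrow> 0)"

definition ext_exp :: "'a::{real_algebra_1,comm_ring_1} poly \<Rightarrow> 'a poly set \<Rightarrow> 'a poly set"
  where "ext_exp p u = (THE s. s \<in> carrier (char_ext p) \<and>
    ext_tendsto p
      (\<lambda>M. \<Oplus>\<^bsub>char_ext p\<^esub> m \<in> {..<M}. ext_scale p (1 / fact m) (u [^]\<^bsub>char_ext p\<^esub> m)) s)"

text \<open>The special function \<open>f\<^sub>i\<close> is entry \<open>i - 1\<close> of the list.\<close>

definition special_functions ::
    "'a::{euclidean_space,real_algebra_1,comm_ring_1} poly \<Rightarrow> ('a \<Rightarrow> 'a) list"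
  where "special_functions p = (THE fs. length fs = Polynomial.degree p \<and>
    (\<forall>\<zeta>. ext_exp p (ext_gen p \<otimes>\<^bsub>char_ext p\<^esub> ext_emb p \<zeta>) =
      (\<Oplus>\<^bsub>char_ext p\<^esub> i \<in> {..<Polynomial.degree p}.
         ext_emb p ((fs ! i) \<zeta>) \<otimes>\<^bsub>char_ext p\<^esub> (ext_gen p [^]\<^bsub>char_ext p\<^esub> i))))"

end

(* Write k^m = b_0(m) + ... + b_{n-1}(m) k^(n-1) in the extension algebra.  Then f_(i+1) is the series
   of b_i(m) z^m / m!, and differentiating such a series shifts its coefficient sequence.  Hence p(D)
   annihilates f_(i+1) because the b_i satisfy the linear recurrence given by p, and independence
   follows by evaluating derivatives at 0, since the j-th derivative of f_(i+1) at 0 is b_i(j), which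
   is the Kronecker delta for j < n. *)

theory Submission
  imports Defs
begin

subsection \<open>Exponential generating series over the algebra\<close>

text \<open>The norm of \<open>'a\<close> is not assumed submultiplicative and \<open>1\<close> need
  not have norm 1, so estimates use a constant \<open>K\<close> with
  \<open>norm (x * y) \<le> K * norm x * norm y\<close>, which finite dimension provides. The
  coefficient ring may have zero divisors; division with remainder by \<open>p\<close> rests on
  \<open>p\<close> being monic. The extension algebra depends on the term \<open>p\<close>, so it is
  not a type and carries no topology of its own; the analysis therefore takes place in the algebra
  itself, coordinate by coordinate in 1, k, ..., k^(n-1). Two facts link this to
  \<open>ext_exp\<close>, whose definition speaks of all norms on the quotient: every such norm is
  dominated by the real coordinates, so coordinatewise convergence yields a limit; and at least one
  norm exists, so the limit is unique. The coordinate series converge everywhere because b_i(m)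
  grows at most geometrically in m.\<close>

lemma bounded_bilinear_alg_mult:
  "bounded_bilinear ((*) :: 'a::{euclidean_space,real_algebra_1} \<Rightarrow> 'a \<Rightarrow> 'a)"
  unfolding bilinear_conv_bounded_bilinear [symmetric] bilinear_def
  by (auto intro!: linearI simp: algebra_simps)

lemma alg_mult_bound:
  obtains K where "K > 0"
    "\<And>x y :: 'a::{euclidean_space,real_algebra_1}. norm (x * y) \<le> K * norm x * norm y"
proof -
  obtain K where K: "K > 0" "\<And>x y :: 'a. norm (x * y) \<le> norm x * norm y * K"
    using bounded_bilinear.pos_bounded [OF bounded_bilinear_alg_mult] by blast
  show thesis
    using K by (intro that [of K]) (simp_all add: mult_ac)
qed

lemma alg_power_bound:
  fixes z :: "'a::{euclidean_space,real_algebra_1}"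
  assumes "\<And>x y :: 'a. norm (x * y) \<le> K * norm x * norm y" "K \<ge> 0"
  shows "norm (z ^ m) \<le> norm (1 :: 'a) * (K * norm z) ^ m"
proof (induction m)
  case (Suc m)
  have "norm (z ^ Suc m) \<le> K * norm z * norm (z ^ m)"
    using assms(1) by simp
  also have "\<dots> \<le> K * norm z * (norm (1 :: 'a) * (K * norm z) ^ m)"
    using Suc assms(2) by (intro mult_left_mono) auto
  finally show ?case by (simp add: mult_ac)
qed simp

text \<open>Geometric growth is enough for the series with terms c(m) z^m / m! to converge on the
  whole algebra. The condition survives shifts and linear combinations, so derivatives and
  combinations of such series can be handled on the coefficient sequences alone.\<close>

definition exp_bounded :: "(nat \<Rightarrow> 'a::real_normed_vector) \<Rightarrow> bool"
  where "exp_bounded c \<longleftrightarrow> (\<exists>C\<ge>0. \<exists>B\<ge>0. \<forall>m. norm (c m) \<le> C * B ^ m)"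

lemma exp_boundedI: "C \<ge> 0 \<Longrightarrow> B \<ge> 0 \<Longrightarrow> (\<And>m. norm (c m) \<le> C * B ^ m) \<Longrightarrow> exp_bounded c"
  unfolding exp_bounded_def by blast

lemma exp_bounded_shift:
  assumes "exp_bounded c"
  shows "exp_bounded (\<lambda>m. c (m + k))"
proof -
  obtain C B where c: "C \<ge> 0" "B \<ge> 0" "\<And>m. norm (c m) \<le> C * B ^ m"
    using assms unfolding exp_bounded_def by blast
  have "norm (c (m + k)) \<le> C * B ^ k * B ^ m" for m
    using c(3) [of "m + k"] by (simp add: power_add mult_ac)
  then show ?thesis
    using c by (intro exp_boundedI [of "C * B ^ k" B]) auto
qed

lemma exp_bounded_add:
  assumes "exp_bounded c" "exp_bounded d"
  shows "exp_bounded (\<lambda>m. c m + d m)"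
proof -
  obtain C B where c: "C \<ge> 0" "B \<ge> 0" "\<And>m. norm (c m) \<le> C * B ^ m"
    using assms(1) unfolding exp_bounded_def by blast
  obtain C' B' where d: "C' \<ge> 0" "B' \<ge> 0" "\<And>m. norm (d m) \<le> C' * B' ^ m"
    using assms(2) unfolding exp_bounded_def by blast
  show ?thesis
  proof (rule exp_boundedI)
    fix m
    have "norm (c m + d m) \<le> C * B ^ m + C' * B' ^ m"
      using norm_triangle_ineq [of "c m" "d m"] c(3) [of m] d(3) [of m] by linarith
    also have "\<dots> \<le> C * max B B' ^ m + C' * max B B' ^ m"
      using c d by (intro add_mono mult_left_mono power_mono) auto
    finally show "norm (c m + d m) \<le> (C + C') * max B B' ^ m"
      by (simp add: algebra_simps)
  qed (use c d in auto)
qed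

lemma exp_bounded_mult_left:
  fixes c :: "nat \<Rightarrow> 'a::{euclidean_space,real_algebra_1}"
  assumes "exp_bounded c"
  shows "exp_bounded (\<lambda>m. a * c m)"
proof -
  obtain C B where c: "C \<ge> 0" "B \<ge> 0" "\<And>m. norm (c m) \<le> C * B ^ m"
    using assms unfolding exp_bounded_def by blast
  obtain K where K: "K > 0" "\<And>x y :: 'a. norm (x * y) \<le> K * norm x * norm y"
    using alg_mult_bound by blast
  show ?thesis
  proof (rule exp_boundedI)
    fix m
    have "norm (a * c m) \<le> K * norm a * norm (c m)" by (rule K)
    also have "\<dots> \<le> K * norm a * (C * B ^ m)"
      using c K by (intro mult_left_mono) auto
    finally show "norm (a * c m) \<le> (K * norm a * C) * B ^ m"
      by (simp add: mult_ac)
  qed (use c K in auto)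
qed

lemma exp_bounded_sum:
  assumes "\<And>i. i \<in> I \<Longrightarrow> exp_bounded (c i)"
  shows "exp_bounded (\<lambda>m. \<Sum>i\<in>I. c i m)"
proof -
  have zero: "exp_bounded (\<lambda>m. 0 :: 'b)"
    by (rule exp_boundedI [of 0 0]) auto
  show ?thesis
    using assms by (induction I rule: infinite_finite_induct) (auto simp: zero exp_bounded_add)
qed

definition exp_term :: "(nat \<Rightarrow> 'a::{euclidean_space,real_algebra_1}) \<Rightarrow> nat \<Rightarrow> 'a \<Rightarrow> 'a"
  where "exp_term c m z = (1 / fact m) *\<^sub>R (c m * z ^ m)"

definition exp_series :: "(nat \<Rightarrow> 'a::{euclidean_space,real_algebra_1}) \<Rightarrow> 'a \<Rightarrow> 'a"
  where "exp_series c z = (\<Sum>m. exp_term c m z)"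

text \<open>The bound is uniform on a ball, so that it serves both pointwise summability and the
  Weierstrass test behind termwise differentiation.\<close>

lemma exp_term_majorant:
  fixes c :: "nat \<Rightarrow> 'a::{euclidean_space,real_algebra_1}"
  assumes "exp_bounded c"
  obtains M where "summable M" "\<And>m z. norm z \<le> r \<Longrightarrow> norm (exp_term c m z) \<le> M m"
proof -
  obtain C B where c: "C \<ge> 0" "B \<ge> 0" "\<And>m. norm (c m) \<le> C * B ^ m"
    using assms unfolding exp_bounded_def by blast
  obtain K where K: "K > 0" "\<And>x y :: 'a. norm (x * y) \<le> K * norm x * norm y"
    using alg_mult_bound by blast
  \<comment> \<open>One factor \<open>K\<close> comes from multiplying \<open>c m\<close> by
    \<open>z ^ m\<close>, the other \<open>m\<close> from the power itself; \<open>norm 1\<close> is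
    the norm of the empty power. Up to the factor \<open>L\<close>, \<open>M\<close> is the real
    exponential series at \<open>B * (K * r)\<close>.\<close>
  define L where "L = K * C * norm (1 :: 'a)"
  define M where "M m = L * ((B * (K * r)) ^ m /\<^sub>R fact m)" for m
  have "summable M"
    unfolding M_def by (intro summable_mult summable_exp_generic)
  moreover have "norm (exp_term c m z) \<le> M m" if "norm z \<le> r" for m z
  proof -
    have "norm (c m * z ^ m) \<le> K * norm (c m) * norm (z ^ m)" by (rule K)
    also have "\<dots> \<le> K * (C * B ^ m) * (norm (1 :: 'a) * (K * norm z) ^ m)"
      using c K alg_power_bound [OF K(2), of z m] by (intro mult_mono mult_nonneg_nonneg) auto
    also have "\<dots> \<le> K * (C * B ^ m) * (norm (1 :: 'a) * (K * r) ^ m)"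
      using c K that by (intro mult_left_mono power_mono mult_nonneg_nonneg) auto
    also have "\<dots> = L * (B * (K * r)) ^ m"
      unfolding L_def power_mult_distrib by (simp add: mult_ac)
    finally have "norm (c m * z ^ m) / fact m \<le> L * (B * (K * r)) ^ m / fact m"
      by (intro divide_right_mono) auto
    then show ?thesis by (simp add: exp_term_def M_def field_simps)
  qed
  ultimately show ?thesis using that by blast
qed

lemma summable_exp_term:
  assumes "exp_bounded c"
  shows "summable (\<lambda>m. exp_term c m z)"
  by (rule exp_term_majorant [OF assms, of "norm z"]) (metis order_refl summable_comparison_test')

lemma exp_series_sums:
  assumes "exp_bounded c"
  shows "(\<lambda>m. exp_term c m z) sums exp_series c z"
  using summable_exp_term [OF assms] unfolding exp_series_def by (rule summable_sums)

lemma exp_series_lincomb: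
  fixes c :: "'i \<Rightarrow> nat \<Rightarrow> 'a::{euclidean_space,real_algebra_1}"
  assumes "\<And>i. i \<in> I \<Longrightarrow> exp_bounded (c i)"
  shows "exp_series (\<lambda>m. \<Sum>i\<in>I. a i * c i m) z = (\<Sum>i\<in>I. a i * exp_series (c i) z)"
proof -
  have "(\<lambda>m. a i * exp_term (c i) m z) sums (a i * exp_series (c i) z)" if "i \<in> I" for i
    by (intro bounded_linear.sums
        [OF bounded_bilinear.bounded_linear_right [OF bounded_bilinear_alg_mult]]
        exp_series_sums assms that)
  then have "(\<lambda>m. \<Sum>i\<in>I. a i * exp_term (c i) m z) sums (\<Sum>i\<in>I. a i * exp_series (c i) z)"
    by (rule sums_sum)
  moreover have "(\<Sum>i\<in>I. a i * exp_term (c i) m z) = exp_term (\<lambda>m. \<Sum>i\<in>I. a i * c i m) m z" for m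
    by (simp add: exp_term_def scaleR_sum_right sum_distrib_right mult.assoc)
  ultimately show ?thesis
    unfolding exp_series_def by (simp add: sums_iff)
qed

lemma exp_series_zero: "exp_series (\<lambda>m. 0) z = 0"
  by (simp add: exp_series_def exp_term_def)

lemma exp_series_at_0: "exp_series c 0 = c 0"
proof -
  have "exp_series c 0 = (\<Sum>m\<in>{0}. exp_term c m 0)"
    unfolding exp_series_def by (rule suminf_finite) (auto simp: exp_term_def gr0_conv_Suc)
  then show ?thesis by (simp add: exp_term_def)
qed

section \<open>Termwise differentiation of exponential generating series\<close>

lemma alg_power_has_derivative:
  fixes z :: "'a::{euclidean_space,real_algebra_1,comm_ring_1}"
  shows "((\<lambda>z. z ^ m) has_derivative (\<lambda>h. real m *\<^sub>R (z ^ (m - 1) * h))) (at z within S)"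
proof (induction m)
  case (Suc m)
  have "((\<lambda>z. z * z ^ m) has_derivative (\<lambda>h. z * (real m *\<^sub>R (z ^ (m - 1) * h)) + h * z ^ m))
      (at z within S)"
    by (rule bounded_bilinear.FDERIV [OF bounded_bilinear_alg_mult has_derivative_ident Suc])
  moreover have "z * (real m *\<^sub>R (z ^ (m - 1) * h)) + h * z ^ m =
      real (Suc m) *\<^sub>R (z ^ (Suc m - 1) * h)" for h
  proof -
    have "real (Suc m) *\<^sub>R x = x + real m *\<^sub>R x" for x :: 'a
      by (simp add: scaleR_left_distrib)
    then show ?thesis
      by (cases m) (simp_all add: mult_ac del: of_nat_Suc)
  qed
  ultimately show ?case by simp
qed simp

lemma exp_series_has_derivative:
  fixes c :: "nat \<Rightarrow> 'a::{euclidean_space,real_algebra_1,comm_ring_1}"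
  assumes "exp_bounded c"
  shows "(exp_series c has_derivative (\<lambda>h. exp_series (\<lambda>m. c (m + 1)) q * h)) (at q)"
proof -
  define d where "d m = c (m + 1)" for m
  \<comment> \<open>A convex open neighbourhood of \<open>q\<close> that is bounded, so that one
    majorant controls the differentiated series on all of it.\<close>
  define S where "S = ball (0 :: 'a) (norm q + 1)"
  \<comment> \<open>The factor m from the power cancels against m!, which turns term m of
    \<open>c\<close> into term m - 1 of the shifted sequence \<open>d\<close>.\<close>
  define f' where "f' m z h = (case m of 0 \<Rightarrow> 0 | Suc k \<Rightarrow> exp_term d k z * h)" for m and z h :: 'a
  have d: "exp_bounded d"
    unfolding d_def by (rule exp_bounded_shift [OF assms])
  obtain K where K: "K > 0" "\<And>x y :: 'a. norm (x * y) \<le> K * norm x * norm y"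
    using alg_mult_bound by blast
  obtain M where M: "summable M" "\<And>m z. norm z \<le> norm q + 1 \<Longrightarrow> norm (exp_term d m z) \<le> M m"
    using exp_term_majorant [OF d] by blast
  have lim: "uniform_limit S (\<lambda>N z. \<Sum>i<N. exp_term d i z) (exp_series d) sequentially"
    unfolding exp_series_def by (rule Weierstrass_m_test [OF _ M(1)]) (auto simp: S_def intro!: M(2))
  have "\<exists>g. \<forall>z\<in>S. (\<lambda>m. exp_term c m z) sums g z \<and>
      (g has_derivative (\<lambda>h. exp_series d z * h)) (at z within S)"
  proof (rule has_derivative_series)
    show "convex S" by (simp add: S_def)
    show "q \<in> S" by (simp add: S_def)
    show "(\<lambda>m. exp_term c m q) sums exp_series c q" by (rule exp_series_sums [OF assms])
    show "(exp_term c m has_derivative f' m z) (at z within S)" for m z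
    proof -
      have "(exp_term c m has_derivative
          (\<lambda>h. (1 / fact m) *\<^sub>R (c m * (real m *\<^sub>R (z ^ (m - 1) * h))))) (at z within S)"
        unfolding exp_term_def
        by (intro has_derivative_scaleR_right alg_power_has_derivative
            bounded_linear.has_derivative
            [OF bounded_bilinear.bounded_linear_right [OF bounded_bilinear_alg_mult]])
      moreover have "(1 / fact m) *\<^sub>R (c m * (real m *\<^sub>R (z ^ (m - 1) * h))) = f' m z h" for h
        by (cases m) (auto simp: f'_def d_def exp_term_def mult_ac simp del: of_nat_Suc)
      ultimately show ?thesis by simp
    qed
    fix e :: real
    assume "e > 0"
    \<comment> \<open>Multiplication by \<open>h\<close> costs a factor \<open>K\<close>, so the
      partial sums must be uniformly within \<open>e / K\<close>.\<close>
    then have "e / K > 0" using K by simp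
    from uniform_limitD [OF lim this]
    have "\<forall>\<^sub>F N in sequentially. \<forall>z\<in>S. \<forall>h.
        norm ((\<Sum>i<Suc N. f' i z h) - exp_series d z * h) \<le> e * norm h"
    proof (rule eventually_mono, intro ballI allI)
      fix N z h
      assume "\<forall>z\<in>S. dist (\<Sum>i<N. exp_term d i z) (exp_series d z) < e / K" "z \<in> S"
      then have *: "norm ((\<Sum>i<N. exp_term d i z) - exp_series d z) \<le> e / K"
        by (auto simp: dist_norm less_imp_le)
      \<comment> \<open>Since \<open>f' 0\<close> vanishes, \<open>Suc N\<close> derivative terms
        correspond to \<open>N\<close> terms of the shifted series.\<close>
      have "(\<Sum>i<Suc N. f' i z h) = (\<Sum>i<N. exp_term d i z * h)"
        unfolding sum.lessThan_Suc_shift by (simp add: f'_def)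
      then have "norm ((\<Sum>i<Suc N. f' i z h) - exp_series d z * h) =
          norm (((\<Sum>i<N. exp_term d i z) - exp_series d z) * h)"
        by (simp only: sum_distrib_right left_diff_distrib)
      also have "\<dots> \<le> K * norm ((\<Sum>i<N. exp_term d i z) - exp_series d z) * norm h"
        by (rule K)
      also have "\<dots> \<le> K * (e / K) * norm h"
        using * K by (intro mult_right_mono mult_left_mono) auto
      finally show "norm ((\<Sum>i<Suc N. f' i z h) - exp_series d z * h) \<le> e * norm h"
        using K by simp
    qed
    then show "\<forall>\<^sub>F N in sequentially. \<forall>z\<in>S. \<forall>h.
        norm ((\<Sum>i<N. f' i z h) - exp_series d z * h) \<le> e * norm h"
      by (rule eventually_sequentially_Suc [THEN iffD1])
  qed
  then obtain g where g: "\<And>z. z \<in> S \<Longrightarrow> (\<lambda>m. exp_term c m z) sums g z"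
      "\<And>z. z \<in> S \<Longrightarrow> (g has_derivative (\<lambda>h. exp_series d z * h)) (at z within S)"
    by blast
  have S: "open S" "q \<in> S" by (auto simp: S_def)
  have "(g has_derivative (\<lambda>h. exp_series d q * h)) (at q)"
    using g(2) [OF S(2)] at_within_open [OF S(2,1)] by simp
  moreover have "g z = exp_series c z" if "z \<in> S" for z
    using g(1) [OF that] exp_series_sums [OF assms] by (rule sums_unique2)
  ultimately have "(exp_series c has_derivative (\<lambda>h. exp_series d q * h)) (at q)"
    using S by (auto intro: has_derivative_transform_within_open)
  then show ?thesis by (simp add: d_def [abs_def])
qed

lemma exp_series_has_alg_differential:
  assumes "exp_bounded c"
  shows "has_alg_differential (exp_series c) (\<lambda>h. exp_series (\<lambda>m. c (m + 1)) q * h) q"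
  using exp_series_has_derivative [OF assms] by (auto simp: has_alg_differential_def mult_ac)

lemma alg_deriv_eq:
  assumes "has_alg_differential f d q"
  shows "alg_deriv f q = d 1"
proof -
  have "(THE d. has_alg_differential f d q) = d"
    using assms by (intro the_equality) (auto simp: has_alg_differential_def intro: has_derivative_unique)
  then show ?thesis by (simp add: alg_deriv_def)
qed

lemma alg_deriv_exp_series:
  "exp_bounded c \<Longrightarrow> alg_deriv (exp_series c) = exp_series (\<lambda>m. c (m + 1))"
  using alg_deriv_eq [OF exp_series_has_alg_differential] by fastforce

lemma alg_deriv_iter_exp_series:
  assumes "exp_bounded c"
  shows "(alg_deriv ^^ j) (exp_series c) = exp_series (\<lambda>m. c (m + j))"
  by (induction j) (simp_all add: alg_deriv_exp_series exp_bounded_shift assms)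

lemma times_alg_differentiable_exp_series:
  "exp_bounded c \<Longrightarrow> times_alg_differentiable n (exp_series c)"
  unfolding times_alg_differentiable_def alg_differentiable_def
  by (metis alg_deriv_iter_exp_series exp_bounded_shift exp_series_has_alg_differential)

text \<open>The j-th derivative at 0 is the constant term of the series shifted j times, that is,
  coefficient j. Both the distinctness of the special functions and their linear independence are
  reduced to this.\<close>

lemma exp_series_inject:
  fixes c d :: "nat \<Rightarrow> 'a::{euclidean_space,real_algebra_1,comm_ring_1}"
  assumes "exp_bounded c" "exp_bounded d" "exp_series c = exp_series d"
  shows "c = d"
proof
  fix j
  have "(alg_deriv ^^ j) (exp_series c) 0 = (alg_deriv ^^ j) (exp_series d) 0"
    by (simp add: assms(3))
  then show "c j = d j"
    unfolding alg_deriv_iter_exp_series [OF assms(1)] alg_deriv_iter_exp_series [OF assms(2)]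
    by (simp add: exp_series_at_0)
qed

lemma poly_deriv_op_exp_series:
  fixes c :: "nat \<Rightarrow> 'a::{euclidean_space,real_algebra_1,comm_ring_1}"
  assumes "exp_bounded c"
  shows "poly_deriv_op p (exp_series c) z =
    exp_series (\<lambda>m. \<Sum>i\<le>Polynomial.degree p. Polynomial.coeff p i * c (m + i)) z"
  unfolding poly_deriv_op_def
  by (subst exp_series_lincomb) (simp_all add: alg_deriv_iter_exp_series exp_bounded_shift assms)

subsection \<open>Powers of the generator modulo the polynomial\<close>

text \<open>For monic \<open>p\<close> of positive degree n this is the remainder of x^m modulo
  \<open>p\<close>. After multiplication by x the coefficient at n - 1 moves to n, and subtracting
  that multiple of \<open>p\<close> removes it. The explicit recursion also yields the growth
  estimate.\<close>

primrec power_rem :: "'a::comm_ring_1 poly \<Rightarrow> nat \<Rightarrow> 'a poly" where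
  "power_rem p 0 = 1"
| "power_rem p (Suc m) = pCons 0 (power_rem p m) -
    Polynomial.smult (Polynomial.coeff (power_rem p m) (Polynomial.degree p - 1)) p"

text \<open>This is b_i(m); the exponent comes last so that \<open>power_coeff p i\<close> is itself
  a coefficient sequence.\<close>

definition power_coeff :: "'a::comm_ring_1 poly \<Rightarrow> nat \<Rightarrow> nat \<Rightarrow> 'a"
  where "power_coeff p i m = Polynomial.coeff (power_rem p m) i"

definition poly_of :: "nat \<Rightarrow> (nat \<Rightarrow> 'a::comm_ring_1) \<Rightarrow> 'a poly"
  where "poly_of n u = (\<Sum>i<n. Polynomial.monom (u i) i)"

lemma coeff_poly_of: "Polynomial.coeff (poly_of n u) i = (if i < n then u i else 0)"
  by (simp add: poly_of_def coeff_sum)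

lemma degree_poly_of: "n > 0 \<Longrightarrow> Polynomial.degree (poly_of n u) < n"
  by (rule degree_lessI) (auto simp: coeff_poly_of)

text \<open>Uniqueness of remainders: the leading coefficient of a nonzero cofactor is multiplied by
  1 and so survives even among zero divisors, hence a nonzero multiple of \<open>p\<close> has
  degree at least that of \<open>p\<close>.\<close>

lemma monic_dvd_degree_less_imp_eq:
  fixes p :: "'a::comm_ring_1 poly"
  assumes "Polynomial.lead_coeff p = 1" "p dvd a - b"
    and "Polynomial.degree a < Polynomial.degree p" "Polynomial.degree b < Polynomial.degree p"
  shows "a = b"
proof (rule ccontr)
  assume "a \<noteq> b"
  obtain g where g: "a - b = p * g" using assms(2) by (rule dvdE)
  with \<open>a \<noteq> b\<close> have "g \<noteq> 0" by auto
  then have "Polynomial.coeff (a - b) (Polynomial.degree p + Polynomial.degree g) \<noteq> 0"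
    using assms(1) unfolding g coeff_mult_degree_sum by simp
  moreover have "Polynomial.degree (a - b) < Polynomial.degree p"
    using assms(3,4) by (rule degree_diff_less)
  ultimately show False by (metis coeff_eq_0 trans_less_add1)
qed

lemma degree_power_rem:
  fixes p :: "'a::comm_ring_1 poly"
  assumes "Polynomial.lead_coeff p = 1" "Polynomial.degree p > 0"
  shows "Polynomial.degree (power_rem p m) < Polynomial.degree p"
proof (induction m)
  case 0
  then show ?case using assms by simp
next
  case (Suc m)
  obtain k where k: "Polynomial.degree p = Suc k" using assms(2) gr0_conv_Suc by auto
  show ?case
  proof (rule degree_lessI)
    show "\<forall>i\<ge>Polynomial.degree p. Polynomial.coeff (power_rem p (Suc m)) i = 0"
    proof (intro allI impI)
      fix i
      assume "i \<ge> Polynomial.degree p"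
      \<comment> \<open>At the degree of \<open>p\<close> the two contributions cancel because
        \<open>p\<close> is monic; above it both vanish for degree reasons.\<close>
      then consider "i = Suc k" | j where "i = Suc j" "j > k"
        using k by (metis Suc_le_D le_neq_implies_less not_less_eq)
      then show "Polynomial.coeff (power_rem p (Suc m)) i = 0"
        using assms Suc k by cases (auto simp: coeff_eq_0)
    qed
  qed (use assms in auto)
qed

lemma power_rem_cong:
  fixes p :: "'a::comm_ring_1 poly"
  shows "p dvd Polynomial.monom 1 m - power_rem p m"
proof (induction m)
  case (Suc m)
  have "Polynomial.monom 1 (Suc m) - power_rem p (Suc m) =
      [:0, 1:] * (Polynomial.monom 1 m - power_rem p m) +
      p * [:Polynomial.coeff (power_rem p m) (Polynomial.degree p - 1):]"
    by (simp add: monom_Suc algebra_simps)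
  then show ?case using Suc by (metis dvd_add dvd_mult dvd_triv_left)
qed simp

text \<open>Below the degree of \<open>p\<close> the monomial x^m is already reduced, so it is its
  own remainder.\<close>

lemma power_coeff_less:
  fixes p :: "'a::comm_ring_1 poly"
  assumes "Polynomial.lead_coeff p = 1" "m < Polynomial.degree p"
  shows "power_coeff p i m = (if i = m then 1 else 0)"
proof -
  have "Polynomial.monom 1 m = power_rem p m"
    using assms
    by (intro monic_dvd_degree_less_imp_eq [of p] power_rem_cong degree_power_rem)
      (auto simp: degree_monom_eq)
  then show ?thesis by (metis power_coeff_def coeff_monom)
qed

text \<open>The product x^m p is 0 modulo \<open>p\<close>. Replacing each of its powers x^(m+j) by
  the remainder leaves a polynomial \<open>s\<close> that is divisible by \<open>p\<close> and has
  smaller degree, so \<open>s\<close> is 0; the claim is its coefficient at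
  \<open>i\<close>.\<close>

lemma power_coeff_recurrence:
  fixes p :: "'a::comm_ring_1 poly"
  assumes "Polynomial.lead_coeff p = 1" "Polynomial.degree p > 0"
  shows "(\<Sum>j\<le>Polynomial.degree p. Polynomial.coeff p j * power_coeff p i (m + j)) = 0"
proof -
  define s where
    "s = (\<Sum>j\<le>Polynomial.degree p. Polynomial.smult (Polynomial.coeff p j) (power_rem p (m + j)))"
  have "p dvd (\<Sum>j\<le>Polynomial.degree p. Polynomial.smult (Polynomial.coeff p j)
      (Polynomial.monom 1 (m + j) - power_rem p (m + j)))"
    by (intro dvd_sum dvd_smult power_rem_cong)
  also have "\<dots> = Polynomial.monom 1 m * (\<Sum>j\<le>Polynomial.degree p. Polynomial.monom (Polynomial.coeff p j) j) - s"
    by (simp add: s_def smult_diff_right sum_subtractf sum_distrib_left smult_monom mult_monom)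
  also have "\<dots> = Polynomial.monom 1 m * p - s"
    by (simp add: poly_as_sum_of_monoms)
  finally have "p dvd 0 - s"
    by (simp add: dvd_diff_right_iff)
  moreover have "Polynomial.degree s < Polynomial.degree p"
    unfolding s_def using assms degree_power_rem [OF assms]
    by (intro degree_sum_less) (auto intro: le_less_trans [OF degree_smult_le])
  ultimately have "0 = s"
    using assms by (intro monic_dvd_degree_less_imp_eq [of p]) auto
  then have "Polynomial.coeff s i = 0" by (metis coeff_0)
  then show ?thesis by (simp add: s_def coeff_sum power_coeff_def)
qed

lemma exp_bounded_power_coeff:
  fixes p :: "'a::{euclidean_space,real_algebra_1,comm_ring_1} poly"
  shows "exp_bounded (power_coeff p i)"
proof -
  obtain K where K: "K > 0" "\<And>x y :: 'a. norm (x * y) \<le> K * norm x * norm y"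
    using alg_mult_bound by blast
  define P where "P = (\<Sum>j\<le>Polynomial.degree p. norm (Polynomial.coeff p j))"
  have P: "norm (Polynomial.coeff p j) \<le> P" for j
  proof (cases "j \<le> Polynomial.degree p")
    case True
    then show ?thesis unfolding P_def by (intro member_le_sum) auto
  next
    case False
    then show ?thesis by (simp add: coeff_eq_0 P_def sum_nonneg)
  qed
  have P0: "P \<ge> 0" by (simp add: P_def sum_nonneg)
  \<comment> \<open>In one step of the recursion the shift preserves a common bound on all
    coefficients, and the subtracted multiple of \<open>p\<close> adds at most \<open>K * P\<close>
    times it. The start \<open>power_rem p 0 = 1\<close> gives \<open>C\<close>.\<close>
  define B where "B = 1 + K * P"
  define C where "C = norm (1 :: 'a)"
  have B: "B \<ge> 1" using K P0 by (simp add: B_def)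
  have "norm (Polynomial.coeff (power_rem p m) j) \<le> C * B ^ m" for j m
  proof (induction m arbitrary: j)
    case 0
    then show ?case by (auto simp: C_def)
  next
    case (Suc m)
    define t where "t = Polynomial.coeff (power_rem p m) (Polynomial.degree p - 1)"
    have "norm (Polynomial.coeff (pCons 0 (power_rem p m)) j) \<le> C * B ^ m"
      using Suc B by (cases j) (auto simp: C_def)
    moreover have "norm (t * Polynomial.coeff p j) \<le> K * (C * B ^ m) * P"
    proof -
      have "norm (t * Polynomial.coeff p j) \<le> K * norm t * norm (Polynomial.coeff p j)" by (rule K)
      also have "\<dots> \<le> K * (C * B ^ m) * P"
        using K P P0 Suc B by (intro mult_mono mult_nonneg_nonneg) (auto simp: t_def C_def)
      finally show ?thesis .
    qed
    moreover have "norm (Polynomial.coeff (power_rem p (Suc m)) j) \<le>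
        norm (Polynomial.coeff (pCons 0 (power_rem p m)) j) + norm (t * Polynomial.coeff p j)"
      by (simp add: t_def norm_triangle_ineq4)
    ultimately have "norm (Polynomial.coeff (power_rem p (Suc m)) j) \<le> C * B ^ m + K * (C * B ^ m) * P"
      by linarith
    also have "\<dots> = C * B ^ Suc m" by (simp add: B_def algebra_simps)
    finally show ?case .
  qed
  then show ?thesis
    using B by (intro exp_boundedI [of C B]) (auto simp: C_def power_coeff_def)
qed

lemma exp_series_power_coeff_fundamental:
  fixes p :: "'a::{euclidean_space,real_algebra_1,comm_ring_1} poly"
  assumes "Polynomial.lead_coeff p = 1" "Polynomial.degree p > 0"
  shows "fundamental_solution_set p
    ((\<lambda>i. exp_series (power_coeff p i)) ` {..<Polynomial.degree p})"
proof -
  define n where "n = Polynomial.degree p"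
  define F where "F i = exp_series (power_coeff p i)" for i
  \<comment> \<open>A solution set must have exactly n elements, and its scalars are indexed by
    functions; injectivity gives the cardinality and lets sums over the set be rewritten as sums
    over indices.\<close>
  have inj: "inj_on F {..<n}"
  proof (rule inj_onI)
    fix i j
    assume "i \<in> {..<n}" "j \<in> {..<n}" "F i = F j"
    then have "power_coeff p i = power_coeff p j"
      unfolding F_def by (intro exp_series_inject exp_bounded_power_coeff)
    then have "power_coeff p i i = power_coeff p j i" by simp
    then show "i = j"
      using assms \<open>i \<in> {..<n}\<close> by (simp add: power_coeff_less n_def split: if_splits)
  qed
  have sol: "poly_deriv_op p (F i) z = 0" for i z
    unfolding F_def
    by (simp add: poly_deriv_op_exp_series exp_bounded_power_coeff
        power_coeff_recurrence [OF assms] exp_series_zero)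
  have diff: "times_alg_differentiable m (F i)" for m i
    unfolding F_def by (intro times_alg_differentiable_exp_series exp_bounded_power_coeff)
  have indep: "c (F j) = 0"
    if "\<forall>z. (\<Sum>f\<in>F ` {..<n}. c f * f z) = 0" "j < n" for c j
  proof -
    \<comment> \<open>The vanishing combination is itself one series; in its coefficient at
      \<open>j < n\<close> only the summand \<open>i = j\<close> remains.\<close>
    have "exp_series (\<lambda>m. \<Sum>i<n. c (F i) * power_coeff p i m) z = exp_series (\<lambda>m. 0) z" for z
      using that(1)
      by (simp add: exp_series_lincomb exp_bounded_power_coeff exp_series_zero
          sum.reindex [OF inj] flip: F_def)
    then have "(\<lambda>m. \<Sum>i<n. c (F i) * power_coeff p i m) = (\<lambda>m. 0)"
      by (intro exp_series_inject exp_bounded_sum exp_bounded_mult_left exp_bounded_power_coeff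
          exp_boundedI [of 0 0]) auto
    then have "(\<Sum>i<n. c (F i) * power_coeff p i j) = 0" by metis
    then show ?thesis
      using that(2) assms by (simp add: power_coeff_less n_def if_distrib cong: if_cong)
  qed
  have "fundamental_solution_set p (F ` {..<n})"
    unfolding fundamental_solution_set_def
    using sol indep inj diff by (auto simp: card_image n_def)
  then show ?thesis by (simp add: F_def n_def)
qed

subsection \<open>The quotient ring\<close>

text \<open>The projection being a ring homomorphism allows every operation on cosets to be computed
  on polynomial representatives.\<close>

lemma
  fixes p :: "'a::comm_ring_1 poly"
  shows ext_class_hom: "ext_class p \<in> ring_hom ring_of_type_algebra (char_ext p)" (is ?hom)
    and cring_char_ext: "cring (char_ext p)" (is ?cring)
proof -
  interpret R: cring "ring_of_type_algebra :: 'a poly ring"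
    by (rule cring_from_type_algebra)
  interpret I: ideal "PIdl\<^bsub>ring_of_type_algebra\<^esub> p" ring_of_type_algebra
    by (rule R.cgenideal_ideal) (simp add: ring_of_type_algebra_def)
  show ?hom
    using I.rcos_ring_hom unfolding char_ext_def ext_class_def [abs_def] .
  show ?cring
    using I.quotient_is_cring R.is_cring unfolding char_ext_def by blast
qed

lemma ext_class_add: "ext_class p a \<oplus>\<^bsub>char_ext p\<^esub> ext_class p b = ext_class p (a + b)"
  using ring_hom_add [OF ext_class_hom, of a b p] by (simp add: ring_of_type_algebra_def)

lemma ext_class_mult: "ext_class p a \<otimes>\<^bsub>char_ext p\<^esub> ext_class p b = ext_class p (a * b)"
  using ring_hom_mult [OF ext_class_hom, of a b p] by (simp add: ring_of_type_algebra_def)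

lemma ext_class_one: "\<one>\<^bsub>char_ext p\<^esub> = ext_class p 1"
  using ring_hom_one [OF ext_class_hom, of p] by (simp add: ring_of_type_algebra_def)

lemma ext_class_zero: "\<zero>\<^bsub>char_ext p\<^esub> = ext_class p 0"
  using ring_hom_zero [OF ext_class_hom ring_from_type_algebra cring.axioms(1) [OF cring_char_ext], of p]
  by (simp add: ring_of_type_algebra_def)

lemma ext_class_closed: "ext_class p a \<in> carrier (char_ext p)"
  using ring_hom_closed [OF ext_class_hom, of a p] by (simp add: ring_of_type_algebra_def)

lemma ext_class_power: "ext_class p a [^]\<^bsub>char_ext p\<^esub> (m :: nat) = ext_class p (a ^ m)"
  by (induction m) (simp_all add: ext_class_one ext_class_mult mult.commute)

lemma ext_class_diff: "ext_class p a \<ominus>\<^bsub>char_ext p\<^esub> ext_class p b = ext_class p (a - b)"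
proof -
  interpret S: cring "char_ext p" by (rule cring_char_ext)
  have "ext_class p a = ext_class p (a - b) \<oplus>\<^bsub>char_ext p\<^esub> ext_class p b"
    by (simp add: ext_class_add)
  then show ?thesis
    by (simp add: S.minus_eq S.a_assoc S.r_neg ext_class_closed)
qed

lemma ext_class_sum: "(\<Oplus>\<^bsub>char_ext p\<^esub> i \<in> A. ext_class p (f i)) = ext_class p (\<Sum>i\<in>A. f i)"
proof -
  interpret S: cring "char_ext p" by (rule cring_char_ext)
  show ?thesis
    by (induction A rule: infinite_finite_induct)
      (simp_all add: ext_class_zero ext_class_add ext_class_closed)
qed

lemma ext_class_altdef: "ext_class p a = range (\<lambda>x. x * p + a)"
  by (auto simp: ext_class_def a_r_coset_def' cgenideal_def ring_of_type_algebra_def)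

lemma ext_class_eq_iff: "ext_class p a = ext_class p b \<longleftrightarrow> p dvd a - b"
proof
  assume "ext_class p a = ext_class p b"
  moreover have "a \<in> ext_class p a"
    unfolding ext_class_altdef by (rule range_eqI [of _ _ 0]) simp
  ultimately obtain x where "a = x * p + b"
    unfolding ext_class_altdef by blast
  then show "p dvd a - b" by simp
next
  assume "p dvd a - b"
  then obtain k where k: "a - b = p * k" by (rule dvdE)
  have "x * p + a = (x + k) * p + b" "x * p + b = (x - k) * p + a" for x
    using k by (simp_all add: algebra_simps)
  then show "ext_class p a = ext_class p b"
    unfolding ext_class_altdef by blast
qed

lemma carrier_char_ext: "carrier (char_ext p) = range (ext_class p)"
  by (auto simp: char_ext_def FactRing_def A_RCOSETS_def' ext_class_def ring_of_type_algebra_def)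

lemma ext_scale_class: "ext_scale p r (ext_class p q) = ext_class p (Polynomial.smult (of_real r) q)"
  by (simp add: ext_scale_def ext_emb_def ext_class_mult)

text \<open>Division with remainder carried out monomial by monomial: each x^m in a representative
  is replaced by \<open>power_rem p m\<close>.\<close>

lemma ext_class_reduced:
  fixes p :: "'a::comm_ring_1 poly"
  assumes "Polynomial.lead_coeff p = 1" "Polynomial.degree p > 0" "u \<in> carrier (char_ext p)"
  obtains r where "Polynomial.degree r < Polynomial.degree p" "u = ext_class p r"
proof -
  obtain q where q: "u = ext_class p q"
    using assms(3) by (auto simp: carrier_char_ext)
  define r where
    "r = (\<Sum>m\<le>Polynomial.degree q. Polynomial.smult (Polynomial.coeff q m) (power_rem p m))"
  have "p dvd (\<Sum>m\<le>Polynomial.degree q.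
      Polynomial.smult (Polynomial.coeff q m) (Polynomial.monom 1 m - power_rem p m))"
    by (intro dvd_sum dvd_smult power_rem_cong)
  also have "\<dots> = q - r"
    by (simp add: r_def smult_diff_right sum_subtractf smult_monom poly_as_sum_of_monoms)
  finally have "u = ext_class p r"
    by (simp add: q ext_class_eq_iff)
  moreover have "Polynomial.degree r < Polynomial.degree p"
    unfolding r_def using assms(2) degree_power_rem [OF assms(1,2)]
    by (intro degree_sum_less) (auto intro: le_less_trans [OF degree_smult_le])
  ultimately show thesis using that by blast
qed

section \<open>Norms and limits in the extension algebra\<close>

lemma ext_norm_exists:
  fixes p :: "'a::{euclidean_space,real_algebra_1,comm_ring_1} poly"
  assumes "Polynomial.lead_coeff p = 1" "Polynomial.degree p > 0"
  obtains N where "ext_norm p N"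
proof
  define n where "n = Polynomial.degree p"
  \<comment> \<open>The unique reduced representative supplies coordinates, and \<open>N\<close> is
    the sum of their norms.\<close>
  define rep where "rep u = (THE r. Polynomial.degree r < n \<and> u = ext_class p r)" for u
  define N where "N u = (\<Sum>i<n. norm (Polynomial.coeff (rep u) i))" for u
  have rep: "rep (ext_class p r) = r" if "Polynomial.degree r < n" for r
    unfolding rep_def
  proof (rule the_equality)
    fix s
    assume "Polynomial.degree s < n \<and> ext_class p r = ext_class p s"
    then show "s = r"
      using that assms(1) by (auto simp: ext_class_eq_iff n_def intro: monic_dvd_degree_less_imp_eq [symmetric])
  qed (use that in simp)
  have N: "N (ext_class p r) = (\<Sum>i<n. norm (Polynomial.coeff r i))"
    if "Polynomial.degree r < n" for r
    by (simp add: N_def rep that)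
  have red: "\<exists>r. Polynomial.degree r < n \<and> u = ext_class p r" if "u \<in> carrier (char_ext p)" for u
    using ext_class_reduced [OF assms that] unfolding n_def by blast
  have n: "n > 0" using assms by (simp add: n_def)
  have "0 \<le> N u \<and> (N u = 0 \<longleftrightarrow> u = \<zero>\<^bsub>char_ext p\<^esub>)" if u: "u \<in> carrier (char_ext p)" for u
  proof -
    obtain r where r: "Polynomial.degree r < n" "u = ext_class p r" using red [OF u] by blast
    have "N u = 0 \<longleftrightarrow> (\<forall>i<n. Polynomial.coeff r i = 0)"
      using r by (simp add: N sum_nonneg_eq_0_iff Ball_def)
    also have "\<dots> \<longleftrightarrow> r = 0"
      using r(1) by (metis coeff_0 leading_coeff_0_iff)
    also have "\<dots> \<longleftrightarrow> u = \<zero>\<^bsub>char_ext p\<^esub>"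
      using r rep n by (metis degree_0 ext_class_zero)
    finally show ?thesis by (simp add: N_def sum_nonneg)
  qed
  moreover have "N (u \<oplus>\<^bsub>char_ext p\<^esub> v) \<le> N u + N v"
    if uv: "u \<in> carrier (char_ext p)" "v \<in> carrier (char_ext p)" for u v
  proof -
    obtain r s where r: "Polynomial.degree r < n" "u = ext_class p r"
      and s: "Polynomial.degree s < n" "v = ext_class p s"
      using red uv by metis
    have "N (u \<oplus>\<^bsub>char_ext p\<^esub> v) = (\<Sum>i<n. norm (Polynomial.coeff r i + Polynomial.coeff s i))"
      using r s by (simp add: ext_class_add N degree_add_less)
    also have "\<dots> \<le> N u + N v"
      using r s by (simp add: N sum_mono norm_triangle_ineq flip: sum.distrib)
    finally show ?thesis .
  qed
  moreover have "N (ext_scale p c u) = \<bar>c\<bar> * N u" if u: "u \<in> carrier (char_ext p)" for c u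
  proof -
    obtain r where r: "Polynomial.degree r < n" "u = ext_class p r" using red [OF u] by blast
    have "Polynomial.degree (Polynomial.smult (of_real c) r) < n"
      using r(1) degree_smult_le by (rule le_less_trans [rotated])
    then show ?thesis
      using r by (simp add: ext_scale_class N sum_distrib_left flip: scaleR_conv_of_real)
  qed
  ultimately show "ext_norm p N" by (simp add: ext_norm_def)
qed

lemma ext_norm_sum_le:
  assumes "ext_norm p N" "finite A"
  shows "N (ext_class p (\<Sum>i\<in>A. f i)) \<le> (\<Sum>i\<in>A. N (ext_class p (f i)))"
  using assms(2)
proof induction
  case empty
  have "N (ext_class p 0) = 0"
    using assms(1) ext_class_closed [of p 0] by (auto simp: ext_norm_def ext_class_zero)
  then show ?case by simp
next
  case (insert i A)
  have "N (ext_class p (f i) \<oplus>\<^bsub>char_ext p\<^esub> ext_class p (\<Sum>i\<in>A. f i)) \<le>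
      N (ext_class p (f i)) + N (ext_class p (\<Sum>i\<in>A. f i))"
    using assms(1) by (simp add: ext_norm_def ext_class_closed)
  then show ?case using insert by (simp add: ext_class_add)
qed

lemma ext_norm_smult:
  "ext_norm p N \<Longrightarrow> N (ext_class p (Polynomial.smult (of_real r) q)) = \<bar>r\<bar> * N (ext_class p q)"
  by (simp add: ext_norm_def ext_class_closed flip: ext_scale_class)

lemma poly_of_diff: "poly_of n u - poly_of n v = poly_of n (\<lambda>i. u i - v i)"
  by (simp add: poly_of_def diff_monom flip: sum_subtractf)

text \<open>Writing each coordinate of the difference in the real basis \<open>Basis\<close> and
  applying the triangle inequality bounds an arbitrary norm by a fixed combination of absolute
  values of real coordinates, each tending to 0.\<close>

lemma ext_tendsto_poly_of:
  fixes p :: "'a::{euclidean_space,real_algebra_1,comm_ring_1} poly"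
  assumes "\<And>i. i < n \<Longrightarrow> (\<lambda>m. U m i) \<longlonglongrightarrow> L i"
  shows "ext_tendsto p (\<lambda>m. ext_class p (poly_of n (U m))) (ext_class p (poly_of n L))"
  unfolding ext_tendsto_def
proof (intro allI impI)
  fix N
  assume N: "ext_norm p N"
  define b where "b m = (\<Sum>i<n. \<Sum>e\<in>Basis.
    \<bar>(U m i - L i) \<bullet> e\<bar> * N (ext_class p (Polynomial.monom e i)))" for m
  have "b \<longlonglongrightarrow> (\<Sum>i<n. \<Sum>e\<in>Basis. \<bar>(L i - L i) \<bullet> e\<bar> * N (ext_class p (Polynomial.monom e i)))"
    unfolding b_def by (intro tendsto_intros assms) auto
  then have b: "b \<longlonglongrightarrow> 0" by simp
  have bound: "N (ext_class p (poly_of n (U m)) \<ominus>\<^bsub>char_ext p\<^esub> ext_class p (poly_of n L)) \<le> b m" for m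
  proof -
    define w where "w = (\<lambda>i. U m i - L i)"
    have "poly_of n w = (\<Sum>i<n. \<Sum>e\<in>Basis. Polynomial.smult (of_real (w i \<bullet> e)) (Polynomial.monom e i))"
      unfolding poly_of_def
      by (simp add: smult_monom euclidean_representation flip: scaleR_conv_of_real monom_sum)
    then have "N (ext_class p (poly_of n w)) \<le> (\<Sum>i<n. N (ext_class p
        (\<Sum>e\<in>Basis. Polynomial.smult (of_real (w i \<bullet> e)) (Polynomial.monom e i))))"
      by (simp add: ext_norm_sum_le [OF N])
    also have "\<dots> \<le> (\<Sum>i<n. \<Sum>e\<in>Basis. N (ext_class p
        (Polynomial.smult (of_real (w i \<bullet> e)) (Polynomial.monom e i))))"
      by (intro sum_mono ext_norm_sum_le [OF N]) simp
    also have "\<dots> = b m"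
      by (simp add: b_def w_def ext_norm_smult [OF N])
    finally show ?thesis by (simp add: ext_class_diff poly_of_diff w_def)
  qed
  have nonneg: "0 \<le> N (ext_class p (poly_of n (U m)) \<ominus>\<^bsub>char_ext p\<^esub> ext_class p (poly_of n L))" for m
    using N ext_class_closed unfolding ext_class_diff ext_norm_def by blast
  show "(\<lambda>m. N (ext_class p (poly_of n (U m)) \<ominus>\<^bsub>char_ext p\<^esub> ext_class p (poly_of n L))) \<longlonglongrightarrow> 0"
    by (rule tendsto_sandwich [OF _ _ tendsto_const b]) (simp_all add: bound nonneg)
qed

text \<open>\<open>ext_tendsto\<close> quantifies over all norms and would hold vacuously if there
  were none; the norm constructed above is what separates distinct limits.\<close>

lemma ext_tendsto_unique:
  fixes p :: "'a::{euclidean_space,real_algebra_1,comm_ring_1} poly"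
  assumes p: "Polynomial.lead_coeff p = 1" "Polynomial.degree p > 0"
    and lim: "ext_tendsto p (\<lambda>m. ext_class p (V m)) (ext_class p a)"
      "ext_tendsto p (\<lambda>m. ext_class p (V m)) (ext_class p b)"
  shows "ext_class p a = ext_class p b"
proof -
  obtain N where N: "ext_norm p N" using ext_norm_exists [OF p] by blast
  have "(\<lambda>m. N (ext_class p (V m - b)) + N (ext_class p (V m - a))) \<longlonglongrightarrow> 0"
    using lim N unfolding ext_tendsto_def ext_class_diff by (intro tendsto_add_zero) auto
  moreover have "N (ext_class p (a - b)) \<le> N (ext_class p (V m - b)) + N (ext_class p (V m - a))" for m
  proof -
    have "N (ext_class p (V m - b) \<oplus>\<^bsub>char_ext p\<^esub> ext_class p (a - V m)) \<le>
        N (ext_class p (V m - b)) + N (ext_class p (a - V m))"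
      using N by (simp add: ext_norm_def ext_class_closed)
    moreover have "N (ext_class p (a - V m)) = N (ext_class p (V m - a))"
      using ext_norm_smult [OF N, of "-1" "V m - a"] by simp
    ultimately show ?thesis by (simp add: ext_class_add)
  qed
  ultimately have "N (ext_class p (a - b)) \<le> 0"
    by (intro LIMSEQ_le_const) auto
  moreover have "0 \<le> N (ext_class p (a - b)) \<and>
      (N (ext_class p (a - b)) = 0 \<longleftrightarrow> ext_class p (a - b) = \<zero>\<^bsub>char_ext p\<^esub>)"
    using N ext_class_closed [of p "a - b"] unfolding ext_norm_def by blast
  ultimately have "ext_class p (a - b) = \<zero>\<^bsub>char_ext p\<^esub>"
    by linarith
  then show ?thesis by (simp add: ext_class_zero ext_class_eq_iff)
qed

section \<open>The exponential of k z and identification of the special functions\<close>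

lemma ext_exp_partial_sum:
  fixes p :: "'a::{euclidean_space,real_algebra_1,comm_ring_1} poly"
  assumes p: "Polynomial.lead_coeff p = 1" "Polynomial.degree p > 0"
  shows "(\<Oplus>\<^bsub>char_ext p\<^esub> m \<in> {..<M}. ext_scale p (1 / fact m)
      ((ext_gen p \<otimes>\<^bsub>char_ext p\<^esub> ext_emb p z) [^]\<^bsub>char_ext p\<^esub> m)) =
    ext_class p (poly_of (Polynomial.degree p) (\<lambda>i. \<Sum>m<M. exp_term (power_coeff p i) m z))"
proof -
  define t where "t m = of_real (1 / fact m) * z ^ m" for m
  have t: "exp_term c m z = t m * c m" for c m
    by (simp add: exp_term_def t_def scaleR_conv_of_real mult_ac)
  \<comment> \<open>The element k z is the class of the monomial \<open>[:0, z:]\<close>, so its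
    powers are again classes of monomials.\<close>
  have "[:0, z:] ^ m = Polynomial.monom (z ^ m) m" for m
    using monom_power [of z 1 m] by (simp add: monom_Suc monom_0)
  then have "(\<Oplus>\<^bsub>char_ext p\<^esub> m \<in> {..<M}. ext_scale p (1 / fact m)
      ((ext_gen p \<otimes>\<^bsub>char_ext p\<^esub> ext_emb p z) [^]\<^bsub>char_ext p\<^esub> m)) =
      ext_class p (\<Sum>m<M. Polynomial.monom (t m) m)"
    by (simp add: ext_gen_def ext_emb_def ext_class_mult ext_class_power ext_scale_class
        ext_class_sum smult_monom t_def)
  also have "\<dots> = ext_class p (\<Sum>m<M. Polynomial.smult (t m) (power_rem p m))"
  proof -
    have "p dvd (\<Sum>m<M. Polynomial.smult (t m) (Polynomial.monom 1 m - power_rem p m))"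
      by (intro dvd_sum dvd_smult power_rem_cong)
    then show ?thesis
      by (simp add: ext_class_eq_iff smult_diff_right sum_subtractf smult_monom)
  qed
  also have "(\<Sum>m<M. Polynomial.smult (t m) (power_rem p m)) =
      poly_of (Polynomial.degree p) (\<lambda>i. \<Sum>m<M. exp_term (power_coeff p i) m z)"
  proof (rule poly_eqI)
    fix i
    \<comment> \<open>All remainders are reduced, so collecting the sum by powers of x uses only
      exponents below the degree of \<open>p\<close>.\<close>
    have "Polynomial.coeff (power_rem p m) i = 0" if "\<not> i < Polynomial.degree p" for m
      using degree_power_rem [OF p, of m] that by (intro coeff_eq_0) linarith
    then show "Polynomial.coeff (\<Sum>m<M. Polynomial.smult (t m) (power_rem p m)) i =
        Polynomial.coeff (poly_of (Polynomial.degree p)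
          (\<lambda>i. \<Sum>m<M. exp_term (power_coeff p i) m z)) i"
      by (simp add: coeff_poly_of coeff_sum t power_coeff_def)
  qed
  finally show ?thesis .
qed

text \<open>The description in \<open>ext_exp\<close> is resolved by coordinatewise convergence for
  existence and by uniqueness of limits.\<close>

lemma ext_exp_gen:
  fixes p :: "'a::{euclidean_space,real_algebra_1,comm_ring_1} poly"
  assumes p: "Polynomial.lead_coeff p = 1" "Polynomial.degree p > 0"
  shows "ext_exp p (ext_gen p \<otimes>\<^bsub>char_ext p\<^esub> ext_emb p z) =
    ext_class p (poly_of (Polynomial.degree p) (\<lambda>i. exp_series (power_coeff p i) z))"
proof -
  define V where
    "V M = poly_of (Polynomial.degree p) (\<lambda>i. \<Sum>m<M. exp_term (power_coeff p i) m z)" for M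
  define b where "b = poly_of (Polynomial.degree p) (\<lambda>i. exp_series (power_coeff p i) z)"
  have lim: "ext_tendsto p (\<lambda>M. ext_class p (V M)) (ext_class p b)"
    using exp_series_sums [OF exp_bounded_power_coeff]
    unfolding V_def b_def by (intro ext_tendsto_poly_of) (simp add: sums_def)
  have uniq: "s = ext_class p b"
    if s: "s \<in> carrier (char_ext p)" "ext_tendsto p (\<lambda>M. ext_class p (V M)) s" for s
  proof -
    obtain a where a: "s = ext_class p a" using s(1) by (auto simp: carrier_char_ext)
    show ?thesis
      using ext_tendsto_unique [OF p, of V a b] lim s(2) by (simp only: a)
  qed
  have "ext_exp p (ext_gen p \<otimes>\<^bsub>char_ext p\<^esub> ext_emb p z) =
      (THE s. s \<in> carrier (char_ext p) \<and> ext_tendsto p (\<lambda>M. ext_class p (V M)) s)"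
    by (simp only: ext_exp_def ext_exp_partial_sum [OF p] V_def)
  also have "\<dots> = ext_class p b"
    using lim uniq by (intro the_equality conjI ext_class_closed) auto
  finally show ?thesis by (simp only: b_def)
qed

lemma ext_class_basis_sum:
  fixes p :: "'a::comm_ring_1 poly"
  shows "(\<Oplus>\<^bsub>char_ext p\<^esub> i \<in> {..<n}. ext_emb p (c i) \<otimes>\<^bsub>char_ext p\<^esub> (ext_gen p [^]\<^bsub>char_ext p\<^esub> i)) =
    ext_class p (poly_of n c)"
proof -
  have "[:a:] * q = Polynomial.smult a q" for a and q :: "'a poly"
    by simp
  then show ?thesis
    by (simp only: ext_gen_def ext_emb_def ext_class_mult ext_class_power ext_class_sum
        poly_of_def monom_altdef)
qed

text \<open>Both sides of the defining equation are classes of polynomials of degree below that of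
  \<open>p\<close>. Equal classes then force equal coefficients, which is the independence of 1, k,
  ..., k^(n-1) and determines every list entry at every point.\<close>

lemma special_functions_eq:
  fixes p :: "'a::{euclidean_space,real_algebra_1,comm_ring_1} poly"
  assumes p: "Polynomial.lead_coeff p = 1" "Polynomial.degree p > 0"
  shows "special_functions p = map (\<lambda>i. exp_series (power_coeff p i)) [0..<Polynomial.degree p]"
  unfolding special_functions_def ext_class_basis_sum ext_exp_gen [OF p]
proof (rule the_equality)
  let ?n = "Polynomial.degree p"
  let ?F = "\<lambda>i. exp_series (power_coeff p i)"
  have "poly_of ?n (\<lambda>i. ?F i z) = poly_of ?n (\<lambda>i. (map ?F [0..<?n] ! i) z)" for z
    by (rule poly_eqI) (simp add: coeff_poly_of)
  then show "length (map ?F [0..<?n]) = ?n \<and> (\<forall>z. ext_class p (poly_of ?n (\<lambda>i. ?F i z)) =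
      ext_class p (poly_of ?n (\<lambda>i. (map ?F [0..<?n] ! i) z)))"
    by simp
  fix fs
  assume fs: "length fs = ?n \<and> (\<forall>z. ext_class p (poly_of ?n (\<lambda>i. ?F i z)) =
      ext_class p (poly_of ?n (\<lambda>i. (fs ! i) z)))"
  have "fs ! i = ?F i" if "i < ?n" for i
  proof
    fix z
    have "poly_of ?n (\<lambda>i. ?F i z) = poly_of ?n (\<lambda>i. (fs ! i) z)"
      using fs p by (intro monic_dvd_degree_less_imp_eq [of p] degree_poly_of) (auto simp: ext_class_eq_iff)
    then show "(fs ! i) z = ?F i z"
      using that by (metis coeff_poly_of)
  qed
  with fs show "fs = map ?F [0..<?n]"
    by (intro nth_equalityI) auto
qed

theorem theorem5p19:
  fixes p :: "'a::{euclidean_space,real_algebra_1,comm_ring_1} poly" and n :: nat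
  assumes "Polynomial.lead_coeff p = 1" and "Polynomial.degree p = n" and "n \<ge> 1"
  shows "fundamental_solution_set p (set (special_functions p))"
proof -
  have "Polynomial.degree p > 0" using assms(2,3) by simp
  then show ?thesis
    using exp_series_power_coeff_fundamental [of p] special_functions_eq [of p] assms(1)
    by (simp add: atLeast0LessThan)
qed

end
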